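(* For every integer $n \ge 1$, the linear order $\mathcal{O}$ (defined in the context) on the facets of the simplicial complex $\Delta(n)$ is a shelling order of $\Delta(n)$.
   Context: Write $[n]=\{1,\dots,n\}$. For $n\ge 1$, $\Delta(n)$ is the simplicial complex with vertex set $[n]^3$ whose faces are the sets of vertices $\{(i_1,j_1,k_1),\dots,(i_r,j_r,k_r)\}$ (including the empty set) that can be listed so that $i_1<\cdots<i_r$, $j_1<\cdots<j_r$ and $k_1<\cdots<k_r$. A face is always written $\{v_1,\dots,v_r\}$ with $v_\ell=(i_\ell,j_\ell,k_\ell)$ in this increasing order. A facet is a face that is maximal under inclusion; the dimension of a face $F$ is $|F|-1$ (so $\dim\emptyset=-1$). $\Delta(n)$ need not be pure, i.e. its facets may have different dimensions. The $\sigma$-word of a face $F=\{v_1,\dots,v_r\}$ is the sequence $\sigma(F)=(i_1,j_1,k_1,i_2,j_2,k_2,\dots,i_r,j_r,k_r)$. The order $\mathcal{O}$ on the facets of $\Delta(n)$: $F<G$ if either $\dim F>\dim G$, or $\dim F=\dim G$ and $\sigma(F)$ is lexicographically smaller than $\sigma(G)$. For a face $F$ of a complex, $\overline{F}$ denotes the subcomplex of all subsets of $F$. A linear order $F_1,\dots,F_t$ of the facets of a (not necessarily pure) simplicial complex is a shelling if for every $k=2,\dots,t$ the subcomplex $\left(\bigcup_{i=1}^{k-1}\overline{F_i}\right)\cap\overline{F_k}$ is pure of dimension $\dim F_k-1$ (all of its facets have dimension $\dim F_k-1$). *)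

theory Defs
  imports Main
begin

text \<open>Complexes are given by their set of faces, the empty face included.\<close>

definition simplicial_complex :: "'a set set \<Rightarrow> bool" where
  "simplicial_complex K \<longleftrightarrow>
     (\<forall>F\<in>K. finite F) \<and> (\<forall>F\<in>K. \<forall>G. G \<subseteq> F \<longrightarrow> G \<in> K)"

definition facets :: "'a set set \<Rightarrow> 'a set set" where
  "facets K = {F \<in> K. \<forall>G\<in>K. F \<subseteq> G \<longrightarrow> G = F}"

definition face_dim :: "'a set \<Rightarrow> int" where
  "face_dim F = int (card F) - 1"

definition pure_of_dim :: "'a set set \<Rightarrow> int \<Rightarrow> bool" where
  "pure_of_dim K d \<longleftrightarrow> (\<forall>F \<in> facets K. face_dim F = d)"

text \<open>
  The list \<open>Fs\<close> is indexed from 0, so the first facet is \<open>Fs ! 0\<close> and the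
  condition ranges over all later ones. The subcomplex generated by a face \<open>F\<close> is
  \<open>Pow F\<close>.
\<close>

definition is_shelling :: "'a set set \<Rightarrow> 'a set list \<Rightarrow> bool" where
  "is_shelling K Fs \<longleftrightarrow>
     distinct Fs \<and> set Fs = facets K \<and>
     (\<forall>k \<in> {1..<length Fs}.
        pure_of_dim ((\<Union>i<k. Pow (Fs ! i)) \<inter> Pow (Fs ! k)) (face_dim (Fs ! k) - 1))"

text \<open>
  An order on the facets, given as a strict relation, is a shelling order if it is linear and
  the enumeration of the facets in increasing order (unique by linearity) is a shelling.
\<close>

definition is_shelling_order :: "'a set set \<Rightarrow> ('a set \<times> 'a set) set \<Rightarrow> bool" where
  "is_shelling_order K r \<longleftrightarrow>
     strict_linear_order_on (facets K) r \<and>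
     (\<exists>Fs. sorted_wrt (\<lambda>F G. (F, G) \<in> r) Fs \<and> is_shelling K Fs)"

type_synonym vertex = "nat \<times> nat \<times> nat"

fun vertex_less :: "vertex \<Rightarrow> vertex \<Rightarrow> bool" where
  "vertex_less (i, j, k) (i', j', k') \<longleftrightarrow> i < i' \<and> j < j' \<and> k < k'"

definition Delta :: "nat \<Rightarrow> vertex set set" where
  "Delta n = {F. F \<subseteq> {1..n} \<times> {1..n} \<times> {1..n} \<and>
                 (\<exists>vs. set vs = F \<and> sorted_wrt vertex_less vs)}"

definition face_list :: "vertex set \<Rightarrow> vertex list" where
  "face_list F = (THE vs. set vs = F \<and> sorted_wrt vertex_less vs)"

definition sigma_word :: "vertex set \<Rightarrow> nat list" where
  "sigma_word F = concat (map (\<lambda>(i, j, k). [i, j, k]) (face_list F))"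

definition order_O :: "nat \<Rightarrow> (vertex set \<times> vertex set) set" where
  "order_O n =
     {(F, G). F \<in> facets (Delta n) \<and> G \<in> facets (Delta n) \<and>
        (face_dim F > face_dim G \<or>
         face_dim F = face_dim G \<and> (sigma_word F, sigma_word G) \<in> lexord {(a, b). a < b})}"

lemma simplicial_complex_Delta: "simplicial_complex (Delta n)"
  unfolding simplicial_complex_def
proof (intro conjI ballI allI impI)
  fix F assume "F \<in> Delta n"
  then show "finite F" by (auto simp: Delta_def)
next
  fix F G assume F: "F \<in> Delta n" and G: "G \<subseteq> F"
  then obtain vs where vs: "set vs = F" "sorted_wrt vertex_less vs"
    by (auto simp: Delta_def)
  have "set (filter (\<lambda>v. v \<in> G) vs) = G" using vs(1) G by auto
  moreover have "sorted_wrt vertex_less (filter (\<lambda>v. v \<in> G) vs)"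
    using vs(2) by (rule sorted_wrt_filter)
  ultimately show "G \<in> Delta n" using F G unfolding Delta_def by blast
qed

lemma sorted_vertex_less_unique:
  assumes "sorted_wrt vertex_less vs" "sorted_wrt vertex_less ws" "set vs = set ws"
  shows "vs = ws"
proof -
  have lt: "fst v < fst w" if "vertex_less v w" for v w
    using that by (cases v; cases w) auto
  have irr: "\<not> vertex_less v v" for v using lt[of v v] by auto
  have asym: "\<not> (vertex_less v w \<and> vertex_less w v)" for v w
    using lt[of v w] lt[of w v] by auto
  show ?thesis using assms
  proof (induction vs arbitrary: ws)
    case Nil
    then show ?case by simp
  next
    case (Cons v vs)
    then obtain w ws' where ws: "ws = w # ws'" by (cases ws) auto
    have vw: "v = w"
      using Cons.prems asym[of v w] unfolding ws by auto
    have "v \<notin> set vs" "v \<notin> set ws'"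
      using Cons.prems irr[of v] unfolding ws vw by auto
    then have "set vs = set ws'" using Cons.prems(3) unfolding ws vw by auto
    then show ?case using Cons.IH[of ws'] Cons.prems unfolding ws vw by auto
  qed
qed

lemma face_list:
  assumes "F \<in> Delta n"
  shows "set (face_list F) = F" "sorted_wrt vertex_less (face_list F)"
proof -
  have "\<exists>!vs. set vs = F \<and> sorted_wrt vertex_less vs"
    using assms sorted_vertex_less_unique unfolding Delta_def by blast
  from theI'[OF this]
  show "set (face_list F) = F" "sorted_wrt vertex_less (face_list F)"
    unfolding face_list_def by auto
qed

end

theory Submission
  imports Defs
begin

text \<open>
  Write a facet as \<open>v\<^sub>1 < \<dots> < v\<^sub>r\<close> and put \<open>v\<^sub>0 = (0,0,0)\<close>. If
  \<open>v\<^sub>l \<noteq> v\<^sub>l\<^sub>-\<^sub>1 + (1,1,1)\<close>, then exchanging \<open>v\<^sub>l\<close> for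
  \<open>v\<^sub>l\<^sub>-\<^sub>1 + (1,1,1)\<close> gives a lexicographically smaller face, so any facet containing it
  precedes the given one and contains all its vertices but \<open>v\<^sub>l\<close>. It remains to see that for
  facets \<open>F < G\<close> some vertex of \<open>G\<close> outside \<open>F\<close> is exchangeable in this way. If none is,
  then by induction on \<open>p\<close> the \<open>p\<close>-th vertex of \<open>G\<close> exists and is componentwise at most the
  \<open>p\<close>-th vertex of \<open>F\<close>, for every \<open>p\<close>, whence \<open>F < G\<close> fails.
\<close>

text \<open>A new element is inserted between the elements related to it and the rest; transitivity
  relates the two sides. This lists both the vertices of a chain and the facets of the
  complex.\<close>

lemma ex_sorted_wrt_list_of_finite:
  assumes "finite A" and "transp P"
    and "\<And>x y. x \<in> A \<Longrightarrow> y \<in> A \<Longrightarrow> x \<noteq> y \<Longrightarrow> P x y \<or> P y x"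
  shows "\<exists>xs. set xs = A \<and> distinct xs \<and> sorted_wrt P xs"
  using assms(1,3)
proof (induction A rule: finite_induct)
  case empty
  then show ?case by simp
next
  case (insert x A)
  then obtain xs where xs: "set xs = A" "distinct xs" "sorted_wrt P xs"
    by (metis insertCI)
  let ?l = "filter (\<lambda>y. P y x) xs" and ?r = "filter (\<lambda>y. \<not> P y x) xs"
  have right: "P x y" if "y \<in> set ?r" for y
    using that insert.prems[of x y] insert.hyps(2) xs(1) by auto
  have cross: "P y z" if "y \<in> set ?l" "z \<in> set ?r" for y z
    using that right[of z] \<open>transp P\<close> by (auto dest: transpD)
  have "\<forall>y\<in>set ?l. \<forall>z\<in>set (x # ?r). P y z"
    using cross by simp
  then have "sorted_wrt P (?l @ x # ?r)"
    unfolding sorted_wrt_append sorted_wrt.simps using right sorted_wrt_filter[OF xs(3)] by blast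
  moreover have "set (?l @ x # ?r) = insert x A" "distinct (?l @ x # ?r)"
    using xs insert.hyps(2) by auto
  ultimately show ?case by blast
qed

section \<open>Componentwise comparison of vertices\<close>

fun vertex_le :: "vertex \<Rightarrow> vertex \<Rightarrow> bool" where
  "vertex_le (i, j, k) (i', j', k') \<longleftrightarrow> i \<le> i' \<and> j \<le> j' \<and> k \<le> k'"

fun vertex_succ :: "vertex \<Rightarrow> vertex" where
  "vertex_succ (i, j, k) = (Suc i, Suc j, Suc k)"

lemma vertex_less_trans: "vertex_less u v \<Longrightarrow> vertex_less v w \<Longrightarrow> vertex_less u w"
  by (cases u; cases v; cases w) auto

lemma vertex_less_irrefl: "\<not> vertex_less v v"
  by (cases v) auto

lemma vertex_le_less_trans: "vertex_le u v \<Longrightarrow> vertex_less v w \<Longrightarrow> vertex_less u w"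
  by (cases u; cases v; cases w) auto

lemma vertex_less_imp_le: "vertex_less u v \<Longrightarrow> vertex_le u v"
  by (cases u; cases v) auto

lemma vertex_le_refl: "vertex_le v v"
  by (cases v) auto

text \<open>Coordinates are integers, so \<open>vertex_succ u\<close> is the least vertex strictly
  above \<open>u\<close>. This minimality makes it the right replacement in an exchange.\<close>

lemma vertex_succ_le_iff: "vertex_le (vertex_succ u) v \<longleftrightarrow> vertex_less u v"
  by (cases u; cases v) auto

lemma vertex_less_succ: "vertex_less v (vertex_succ v)"
  by (cases v) auto

section \<open>Faces as chains, and maximal chains\<close>

text \<open>With pairwise comparability in place of a sorted list, adding or replacing a vertex is
  checked one pair at a time.\<close>

lemma Delta_iff:
  "F \<in> Delta n \<longleftrightarrow> F \<subseteq> {1..n} \<times> {1..n} \<times> {1..n} \<and>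
     (\<forall>x\<in>F. \<forall>y\<in>F. x \<noteq> y \<longrightarrow> vertex_less x y \<or> vertex_less y x)"
proof
  assume F: "F \<in> Delta n"
  then obtain vs where vs: "set vs = F" "sorted_wrt vertex_less vs"
    by (auto simp: Delta_def)
  have "vertex_less x y \<or> vertex_less y x" if xy: "x \<in> F" "y \<in> F" "x \<noteq> y" for x y
  proof -
    obtain p q where "p < length vs" "q < length vs" "x = vs ! p" "y = vs ! q"
      using xy vs(1) by (metis in_set_conv_nth)
    then show ?thesis
      using xy(3) vs(2) by (metis sorted_wrt_nth_less linorder_neqE_nat)
  qed
  then show "F \<subseteq> {1..n} \<times> {1..n} \<times> {1..n} \<and>
     (\<forall>x\<in>F. \<forall>y\<in>F. x \<noteq> y \<longrightarrow> vertex_less x y \<or> vertex_less y x)"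
    using F by (auto simp: Delta_def)
next
  assume F: "F \<subseteq> {1..n} \<times> {1..n} \<times> {1..n} \<and>
     (\<forall>x\<in>F. \<forall>y\<in>F. x \<noteq> y \<longrightarrow> vertex_less x y \<or> vertex_less y x)"
  then have "finite F" by (meson finite_SigmaI finite_atLeastAtMost finite_subset)
  moreover have "transp vertex_less"
    using vertex_less_trans by (auto intro: transpI)
  ultimately have "\<exists>vs. set vs = F \<and> distinct vs \<and> sorted_wrt vertex_less vs"
    using F by (intro ex_sorted_wrt_list_of_finite) auto
  then show "F \<in> Delta n" using F unfolding Delta_def by blast
qed

lemma finite_Delta: "finite (Delta n)"
  by (rule finite_subset[of _ "Pow ({1..n} \<times> {1..n} \<times> {1..n})"]) (auto simp: Delta_def)

lemma finite_if_Delta: "F \<in> Delta n \<Longrightarrow> finite F"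
  using simplicial_complex_Delta[of n] by (auto simp: simplicial_complex_def)

lemma face_list_eqI:
  assumes "set vs = F" "sorted_wrt vertex_less vs"
  shows "face_list F = vs"
  unfolding face_list_def
  using assms sorted_vertex_less_unique by (intro the_equality) auto

lemma distinct_face_list:
  assumes "F \<in> Delta n"
  shows "distinct (face_list F)"
proof -
  have "face_list F ! p \<noteq> face_list F ! q" if "p < q" "q < length (face_list F)" for p q
    using sorted_wrt_nth_less[OF face_list(2)[OF assms] that] vertex_less_irrefl by metis
  then show ?thesis unfolding distinct_conv_nth by (metis linorder_neqE_nat)
qed

lemma length_face_list: "F \<in> Delta n \<Longrightarrow> length (face_list F) = card F"
  by (metis distinct_card distinct_face_list face_list(1))

lemma facet_subset_eq: "F \<in> facets K \<Longrightarrow> G \<in> K \<Longrightarrow> F \<subseteq> G \<Longrightarrow> G = F"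
  by (auto simp: facets_def)

lemma facet_in_complex: "F \<in> facets K \<Longrightarrow> F \<in> K"
  by (auto simp: facets_def)

lemma ex_facet_superset:
  assumes "finite K" "F \<in> K"
  shows "\<exists>G\<in>facets K. F \<subseteq> G"
  using finite_has_maximal2[OF assms] by (auto simp: facets_def)

text \<open>Such an \<open>x\<close> could be added to \<open>G\<close>, so it lies in
  \<open>G\<close> by maximality; but then it would be strictly comparable with itself.\<close>

lemma facet_saturated:
  assumes G: "G \<in> facets (Delta n)"
    and x: "x \<in> {1..n} \<times> {1..n} \<times> {1..n}"
    and comparable: "\<And>g. g \<in> G \<Longrightarrow> vertex_less g x \<or> vertex_less x g"
  shows False
proof -
  have "insert x G \<in> Delta n"
    using facet_in_complex[OF G] x comparable unfolding Delta_iff by blast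
  then have "insert x G = G" using facet_subset_eq[OF G] by blast
  then show False using comparable[of x] vertex_less_irrefl[of x] by blast
qed

section \<open>Exchanging a vertex of a facet\<close>

text \<open>The prepended \<open>(0,0,0)\<close> shifts indices by one, so that entry
  \<open>l\<close> of the longer list is the predecessor of vertex \<open>l\<close>, also for
  \<open>l = 0\<close>.\<close>

lemma ex_facet_exchange:
  assumes G: "G \<in> facets (Delta n)" and l: "l < length (face_list G)"
    and ne: "face_list G ! l \<noteq> vertex_succ (((0,0,0) # face_list G) ! l)"
  shows "\<exists>H. (H, G) \<in> order_O n \<and> G - {face_list G ! l} \<subseteq> H"
proof -
  define gs where "gs = face_list G"
  define v where "v = gs ! l"
  define w where "w = vertex_succ (((0,0,0) # gs) ! l)"
  define H\<^sub>0 where "H\<^sub>0 = insert w (G - {v})"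
  have GD: "G \<in> Delta n" using G by (rule facet_in_complex)
  have gs: "set gs = G" "sorted_wrt vertex_less gs" "distinct gs"
    using face_list[OF GD] distinct_face_list[OF GD] by (auto simp: gs_def)
  have l: "l < length gs" using l by (simp add: gs_def)
  have vG: "v \<in> G" using gs(1) l by (auto simp: v_def)
  have box: "G \<subseteq> {1..n} \<times> {1..n} \<times> {1..n}" using GD by (auto simp: Delta_def)
  have before: "vertex_less (gs ! q) w" if "q < l" for q
  proof -
    have "vertex_le (gs ! q) (gs ! (l - 1))"
      using that l sorted_wrt_nth_less[OF gs(2), of q "l - 1"]
      by (cases "q = l - 1") (auto simp: vertex_le_refl vertex_less_imp_le)
    then show ?thesis
      using that vertex_le_less_trans[OF _ vertex_less_succ] by (simp add: w_def nth_Cons')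
  qed
  \<comment> \<open>For \<open>l = 0\<close> this holds because all coordinates of a vertex are at
    least 1.\<close>
  have "vertex_less (((0,0,0) # gs) ! l) v"
  proof (cases l)
    case 0
    then show ?thesis using box vG by (cases v) auto
  next
    case (Suc m)
    then show ?thesis using sorted_wrt_nth_less[OF gs(2), of m l] l by (simp add: v_def)
  qed
  then have wv: "vertex_le w v" by (simp add: w_def vertex_succ_le_iff)
  have after: "vertex_less w (gs ! q)" if "l < q" "q < length gs" for q
    using wv sorted_wrt_nth_less[OF gs(2) that] by (auto simp: v_def intro: vertex_le_less_trans)
  have comparable: "vertex_less g w \<or> vertex_less w g" if g: "g \<in> G - {v}" for g
  proof -
    obtain q where q: "q < length gs" "g = gs ! q" using g gs(1) by (metis DiffD1 in_set_conv_nth)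
    then have "q \<noteq> l" using g by (auto simp: v_def)
    then show ?thesis using q before after by (metis linorder_neqE_nat)
  qed
  have wne: "w \<noteq> v" using ne by (auto simp: w_def v_def gs_def)
  have wG: "w \<notin> G" using comparable[of w] vertex_less_irrefl[of w] wne by blast
  \<comment> \<open>As a successor \<open>w\<close> has positive coordinates, and they are bounded
    by those of \<open>v\<close>.\<close>
  have "w \<in> {1..n} \<times> {1..n} \<times> {1..n}"
    using wv box vG by (cases v; cases "((0,0,0) # gs) ! l") (auto simp: w_def)
  then have H\<^sub>0: "H\<^sub>0 \<in> Delta n"
    using GD comparable unfolding Delta_iff H\<^sub>0_def by blast
  then obtain H where H: "H \<in> facets (Delta n)" "H\<^sub>0 \<subseteq> H"
    using ex_facet_superset[OF finite_Delta] by blast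
  have HD: "H \<in> Delta n" using H(1) by (rule facet_in_complex)
  have cardH\<^sub>0: "card H\<^sub>0 = card G"
    using wG vG finite_if_Delta[OF GD] by (simp add: H\<^sub>0_def card_Suc_Diff1 del: card_Diff_insert)
  \<comment> \<open>\<open>H\<close> has at least as many vertices as \<open>G\<close>. If it has
    more, its dimension puts it first; if not, it is \<open>H\<^sub>0\<close> and the words
    decide.\<close>
  have "(H, G) \<in> order_O n"
  proof (cases "card H = card G")
    case False
    then have "card G < card H"
      using card_mono[OF finite_if_Delta[OF HD] H(2)] cardH\<^sub>0 by linarith
    then show ?thesis using H(1) G by (auto simp: order_O_def face_dim_def)
  next
    case True
    then have HH: "H = H\<^sub>0"
      using card_subset_eq[OF finite_if_Delta[OF HD] H(2)] cardH\<^sub>0 by simp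
    have split: "take l gs @ v # drop (Suc l) gs = gs"
      unfolding v_def by (rule id_take_nth_drop[OF l, symmetric])
    define hs where "hs = take l gs @ w # drop (Suc l) gs"
    have "set (take l gs) \<union> set (drop (Suc l) gs) = G - {v}"
    proof -
      have "distinct (take l gs @ v # drop (Suc l) gs)"
        "set (take l gs @ v # drop (Suc l) gs) = G"
        unfolding split using gs by auto
      then show ?thesis by auto
    qed
    then have "set hs = H" by (auto simp: hs_def HH H\<^sub>0_def)
    moreover have "sorted_wrt vertex_less hs"
    proof -
      have "sorted_wrt vertex_less (take l gs @ v # drop (Suc l) gs)"
        unfolding split by (rule gs(2))
      moreover have "\<forall>x\<in>set (take l gs). vertex_less x w"
        using before l by (simp add: all_set_conv_all_nth)
      moreover have "\<forall>x\<in>set (drop (Suc l) gs). vertex_less w x"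
        using after by (simp add: all_set_conv_all_nth)
      ultimately show ?thesis by (auto simp: hs_def sorted_wrt_append)
    qed
    ultimately have "face_list H = hs" by (rule face_list_eqI)
    moreover have "(sigma_word H, sigma_word G) \<in> lexord {(a, b). a < b}"
    proof -
      let ?word = "\<lambda>vs. concat (map (\<lambda>(i, j, k). [i, j, k]) vs) :: nat list"
      \<comment> \<open>Since \<open>w\<close> is componentwise at most \<open>v\<close> and differs
        from it, the first coordinate where they differ is smaller in \<open>w\<close>.\<close>
      have "(?word (w # drop (Suc l) gs), ?word (v # drop (Suc l) gs)) \<in> lexord {(a, b). a < b}"
        using wv wne by (cases w; cases v) auto
      then have "(?word hs, ?word (take l gs @ v # drop (Suc l) gs)) \<in> lexord {(a, b). a < b}"
        unfolding hs_def map_append concat_append by (rule lexord_append_leftI)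
      then show ?thesis
        unfolding split using \<open>face_list H = hs\<close> by (simp add: sigma_word_def gs_def)
    qed
    ultimately show ?thesis using H(1) G True by (auto simp: order_O_def face_dim_def)
  qed
  moreover have "G - {v} \<subseteq> H" using H(2) by (auto simp: H\<^sub>0_def)
  ultimately show ?thesis by (auto simp: v_def gs_def)
qed

section \<open>Domination when no exchange is available\<close>

text \<open>By induction, the vertices of \<open>G\<close> before position \<open>p\<close> lie
  strictly below the \<open>p\<close>-th vertex \<open>x\<close> of \<open>F\<close>. If
  \<open>G\<close> stopped there, or continued strictly above \<open>x\<close>, then
  \<open>x\<close> would be comparable with all of \<open>G\<close>, contrary to maximality.\<close>

lemma unexchangeable_dominated:
  assumes G: "G \<in> facets (Delta n)" and F: "F \<in> Delta n"
    and step: "\<And>l. l < length (face_list G) \<Longrightarrow> face_list G ! l \<notin> F \<Longrightarrow>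
      face_list G ! l = vertex_succ (((0,0,0) # face_list G) ! l)"
    and p: "p < length (face_list F)"
  shows "p < length (face_list G) \<and> vertex_le (face_list G ! p) (face_list F ! p)"
  using p
proof (induction p rule: less_induct)
  case (less p)
  define gs fs where "gs = face_list G" and "fs = face_list F"
  define x where "x = fs ! p"
  have gs: "set gs = G" "sorted_wrt vertex_less gs"
    using face_list[OF facet_in_complex[OF G]] by (auto simp: gs_def)
  have fs: "set fs = F" "sorted_wrt vertex_less fs"
    using face_list[OF F] by (auto simp: fs_def)
  have p: "p < length fs" using less.prems by (simp add: fs_def)
  then have xF: "x \<in> F" using fs(1) by (auto simp: x_def)
  then have box: "x \<in> {1..n} \<times> {1..n} \<times> {1..n}" using F by (auto simp: Delta_def)
  have before: "vertex_less (gs ! q) x" if "q < p" for q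
    using less.IH[OF that] that p sorted_wrt_nth_less[OF fs(2) that p]
    by (auto simp: gs_def fs_def x_def intro: vertex_le_less_trans)
  have len: "p < length gs"
  proof (rule ccontr)
    assume "\<not> p < length gs"
    then have "vertex_less g x" if "g \<in> G" for g
      using that before gs(1) by (auto simp: in_set_conv_nth)
    then show False using facet_saturated[OF G box] by blast
  qed
  have "vertex_le (gs ! p) x"
  proof (cases "gs ! p \<in> F")
    case False
    \<comment> \<open>Here \<open>gs ! p\<close> is the successor of its predecessor, so it suffices
      that the predecessor is strictly below \<open>x\<close>.\<close>
    have "vertex_less (((0,0,0) # gs) ! p) x"
    proof (cases p)
      case 0
      then show ?thesis using box by (cases x) auto
    next
      case (Suc m)
      then show ?thesis using before by simp
    qed
    then show ?thesis
      using step[of p] False len by (simp add: gs_def vertex_succ_le_iff)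
  next
    case True
    \<comment> \<open>Both vertices lie in the chain \<open>F\<close>, so excluding this case leaves
      \<open>gs ! p\<close> equal to \<open>x\<close> or below it.\<close>
    have "\<not> vertex_less x (gs ! p)"
    proof
      assume above: "vertex_less x (gs ! p)"
      have "vertex_less g x \<or> vertex_less x g" if g: "g \<in> G" for g
      proof -
        obtain q where q: "q < length gs" "g = gs ! q"
          using g gs(1) by (metis in_set_conv_nth)
        consider "q < p" | "q = p" | "p < q" by linarith
        then show ?thesis
        proof cases
          case 3
          then show ?thesis
            using vertex_less_trans[OF above sorted_wrt_nth_less[OF gs(2) 3 q(1)]] q by simp
        qed (use q before above in auto)
      qed
      then show False using facet_saturated[OF G box] by blast
    qed
    then show ?thesis
      using True xF F vertex_le_refl vertex_less_imp_le unfolding Delta_iff by metis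
  qed
  then show ?case using len by (simp add: gs_def fs_def x_def)
qed

text \<open>The lengths agree, so neither list is a proper prefix of the other, and at a first
  difference the entry of \<open>us\<close> is the smaller one.\<close>

lemma list_all2_le_imp_not_lexord:
  fixes us vs :: "nat list"
  assumes "list_all2 (\<le>) us vs"
  shows "(vs, us) \<notin> lexord {(a, b). a < b}"
  using assms by (induction rule: list_all2_induct) auto

lemma list_all2_vertex_le_word:
  assumes "list_all2 vertex_le us vs"
  shows "list_all2 (\<le>) (concat (map (\<lambda>(i, j, k). [i, j, k]) us))
           (concat (map (\<lambda>(i, j, k). [i, j, k]) vs))"
  using assms by (induction rule: list_all2_induct) auto

text \<open>Otherwise domination makes \<open>G\<close> at least as large as \<open>F\<close>, so
  \<open>F\<close> can come first only by its word; but domination also compares the words the other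
  way.\<close>

lemma ex_exchangeable_vertex:
  assumes FG: "(F, G) \<in> order_O n"
  shows "\<exists>l<length (face_list G). face_list G ! l \<notin> F \<and>
           face_list G ! l \<noteq> vertex_succ (((0,0,0) # face_list G) ! l)"
proof (rule ccontr)
  assume neg: "\<not> ?thesis"
  have G: "G \<in> facets (Delta n)" and F: "F \<in> Delta n"
    using FG by (auto simp: order_O_def facets_def)
  note dom = unexchangeable_dominated[OF G F]
  have dom: "p < length (face_list G) \<and> vertex_le (face_list G ! p) (face_list F ! p)"
    if "p < length (face_list F)" for p
    using dom[OF _ that] neg by blast
  \<comment> \<open>Were \<open>F\<close> larger, domination at
    \<open>p = length (face_list G)\<close> would give \<open>p < p\<close>.\<close>
  have "card F \<le> card G"
    using dom length_face_list[OF F] length_face_list[OF facet_in_complex[OF G]]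
    by (metis linorder_not_le order_less_irrefl)
  then have card: "card F = card G" and
    lex: "(sigma_word F, sigma_word G) \<in> lexord {(a, b). a < b}"
    using FG by (auto simp: order_O_def face_dim_def)
  have "list_all2 vertex_le (face_list G) (face_list F)"
    using dom card length_face_list[OF F] length_face_list[OF facet_in_complex[OF G]]
    by (auto simp: list_all2_conv_all_nth)
  then show False
    using lex list_all2_le_imp_not_lexord[OF list_all2_vertex_le_word]
    unfolding sigma_word_def by blast
qed

section \<open>Linearity of the order\<close>

text \<open>Every vertex contributes exactly three letters, so the word can be cut back into
  vertices. Totality of the order rests on this.\<close>

lemma word_inj:
  "concat (map (\<lambda>(i, j, k). [i, j, k]) us) = concat (map (\<lambda>(i, j, k). [i, j, k]) vs) \<Longrightarrow> us = vs"
proof (induction us arbitrary: vs)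
  case Nil
  then show ?case by (cases vs) auto
next
  case (Cons u us)
  then show ?case by (cases vs; cases u) (auto split: prod.splits)
qed

lemma sigma_word_inj:
  assumes "F \<in> Delta n" "G \<in> Delta n" "sigma_word F = sigma_word G"
  shows "F = G"
proof -
  have "face_list F = face_list G"
    using assms(3) unfolding sigma_word_def by (rule word_inj)
  then show ?thesis using face_list(1) assms(1,2) by metis
qed

lemma strict_linear_order_O: "strict_linear_order_on (facets (Delta n)) (order_O n)"
proof -
  let ?r = "{(a, b). a < b} :: (nat \<times> nat) set"
  have tr: "trans (lexord ?r)"
    by (rule lexord_transI) (auto intro: transI)
  have "trans (order_O n)"
    by (rule transI) (auto simp: order_O_def dest: transD[OF tr])
  moreover have "irrefl (order_O n)"
    by (auto simp: irrefl_def order_O_def lexord_irreflexive)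
  moreover have "total_on (facets (Delta n)) (order_O n)"
  proof (rule total_onI)
    fix F G assume FG: "F \<in> facets (Delta n)" "G \<in> facets (Delta n)" "F \<noteq> G"
    then have "sigma_word F \<noteq> sigma_word G"
      using sigma_word_inj facet_in_complex by metis
    moreover have "(sigma_word F, sigma_word G) \<in> lexord ?r \<or> sigma_word F = sigma_word G \<or>
      (sigma_word G, sigma_word F) \<in> lexord ?r"
      by (rule lexord_linear) auto
    ultimately show "(F, G) \<in> order_O n \<or> (G, F) \<in> order_O n"
      using FG by (auto simp: order_O_def)
  qed
  ultimately show ?thesis by (simp add: strict_linear_order_on_def)
qed

section \<open>The shelling condition\<close>

text \<open>A facet \<open>X\<close> of the intersection lies in some \<open>F\<close>, hence misses
  the vertex \<open>v\<close> given for that \<open>F\<close>. So \<open>X\<close> is contained in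
  \<open>G - {v}\<close>, which is itself in the intersection because of \<open>H\<close>, and
  maximality gives equality.\<close>

lemma pure_of_dim_codim_oneI:
  assumes "finite G"
    and "\<And>F. F \<in> \<F> \<Longrightarrow> \<exists>H\<in>\<F>. \<exists>v\<in>G. v \<notin> F \<and> G - {v} \<subseteq> H"
  shows "pure_of_dim ((\<Union>F\<in>\<F>. Pow F) \<inter> Pow G) (face_dim G - 1)"
  unfolding pure_of_dim_def
proof
  fix X assume X: "X \<in> facets ((\<Union>F\<in>\<F>. Pow F) \<inter> Pow G)"
  then obtain F where F: "F \<in> \<F>" "X \<subseteq> F" "X \<subseteq> G" by (auto simp: facets_def)
  then obtain H v where H: "H \<in> \<F>" "v \<in> G" "v \<notin> F" "G - {v} \<subseteq> H"
    using assms(2) by blast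
  then have "G - {v} = X" using F by (intro facet_subset_eq[OF X]) auto
  then show "face_dim X = face_dim G - 1"
    using H(2) \<open>finite G\<close> card_Suc_Diff1[of G v] by (auto simp: face_dim_def)
qed

theorem theorem5p4:
  fixes n :: nat
  assumes "n \<ge> 1"
  shows "is_shelling_order (Delta n) (order_O n)"
proof -
  let ?r = "order_O n"
  have lin: "trans ?r" "irrefl ?r" "total_on (facets (Delta n)) ?r"
    using strict_linear_order_O[of n] by (auto simp: strict_linear_order_on_def)
  have "finite (facets (Delta n))"
    using finite_Delta by (rule finite_subset[rotated]) (auto simp: facets_def)
  moreover have "transp (\<lambda>F G. (F, G) \<in> ?r)"
    using lin(1) by (auto intro: transpI dest: transD)
  ultimately have "\<exists>Fs. set Fs = facets (Delta n) \<and> distinct Fs \<and>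
      sorted_wrt (\<lambda>F G. (F, G) \<in> ?r) Fs"
    using lin(3) by (intro ex_sorted_wrt_list_of_finite) (auto simp: total_on_def)
  then obtain Fs where Fs: "set Fs = facets (Delta n)" "distinct Fs"
    "sorted_wrt (\<lambda>F G. (F, G) \<in> ?r) Fs" by blast
  have "pure_of_dim ((\<Union>i<k. Pow (Fs ! i)) \<inter> Pow (Fs ! k)) (face_dim (Fs ! k) - 1)"
    if k: "k < length Fs" for k
  proof -
    let ?G = "Fs ! k"
    have G: "?G \<in> facets (Delta n)" using Fs(1) k nth_mem by blast
    have "\<exists>H\<in>(!) Fs ` {..<k}. \<exists>v\<in>?G. v \<notin> F \<and> ?G - {v} \<subseteq> H"
      if F: "F \<in> (!) Fs ` {..<k}" for F
    proof -
      have "(F, ?G) \<in> ?r" using F sorted_wrt_nth_less[OF Fs(3) _ k] by auto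
      then obtain l where l: "l < length (face_list ?G)" "face_list ?G ! l \<notin> F"
        "face_list ?G ! l \<noteq> vertex_succ (((0,0,0) # face_list ?G) ! l)"
        using ex_exchangeable_vertex by blast
      then obtain H where H: "(H, ?G) \<in> ?r" "?G - {face_list ?G ! l} \<subseteq> H"
        using ex_facet_exchange[OF G] by blast
      have "H \<in> set Fs" using H(1) Fs(1) by (auto simp: order_O_def)
      then obtain j where j: "j < length Fs" "H = Fs ! j" by (auto simp: in_set_conv_nth)
      \<comment> \<open>The position of \<open>H\<close> in the list must be read off from the
        relation: at \<open>k\<close> or later, sortedness and transitivity would put
        \<open>?G\<close> before itself.\<close>
      have "\<not> k \<le> j"
      proof
        assume "k \<le> j"
        then have "k = j \<or> (?G, H) \<in> ?r"
          using sorted_wrt_nth_less[OF Fs(3), of k j] j by (cases "k = j") auto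
        then have "(?G, ?G) \<in> ?r" using H(1) j(2) lin(1) by (auto dest: transD)
        then show False using lin(2) by (auto simp: irrefl_def)
      qed
      then have "H \<in> (!) Fs ` {..<k}" using j(2) by auto
      moreover have "face_list ?G ! l \<in> ?G"
        using l(1) face_list(1)[OF facet_in_complex[OF G]] nth_mem by blast
      ultimately show ?thesis using H(2) l(2) by blast
    qed
    then have "pure_of_dim ((\<Union>F\<in>(!) Fs ` {..<k}. Pow F) \<inter> Pow ?G) (face_dim ?G - 1)"
      using finite_if_Delta[OF facet_in_complex[OF G]] by (intro pure_of_dim_codim_oneI) auto
    then show ?thesis by simp
  qed
  then have "is_shelling (Delta n) Fs" using Fs(1,2) by (auto simp: is_shelling_def)
  then show ?thesis
    using Fs(3) strict_linear_order_O unfolding is_shelling_order_def by blast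
qed

end
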